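(* Let $d$ be an equidistant metric on a (nonempty) set $X$. Then the following statements are equivalent: (1) $|X| = 1$ or $X$ is an infinite set. (2) The metric spaces $(X,d)$ and $(\bar{\mathbf{B}}_X, d_H)$ are isometric.
   Context: A metric $d$ on a nonempty set $X$ is equidistant if there exists $t>0$ such that $d(x,y)=t$ for all distinct $x,y\in X$. For $c\in X$ and $r\ge 0$ the closed ball is $\bar B_r(c)=\{x\in X: d(c,x)\le r\}$ (so $\bar B_0(c)=\{c\}$). $\bar{\mathbf{B}}_X$ is the set of all closed balls $\bar B_r(c)$, $c\in X$, $r\ge 0$, regarded as subsets of $X$. The Hausdorff distance between nonempty closed bounded sets $A,B\subseteq X$ is $d_H(A,B)=\max\{\sup_{a\in A}\inf_{b\in B}d(a,b),\ \sup_{b\in B}\inf_{a\in A}d(a,b)\}$; $\bar{\mathbf{B}}_X$ is equipped with the metric $d_H$. Two metric spaces are isometric if there is a distance-preserving bijection between them. *)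

theory Defs
  imports "HOL-Analysis.Analysis"
begin

definition equidistant_metric :: "'a set \<Rightarrow> ('a \<Rightarrow> 'a \<Rightarrow> real) \<Rightarrow> bool" where
  "equidistant_metric X d \<longleftrightarrow>
     Metric_space X d \<and> (\<exists>t>0. \<forall>x\<in>X. \<forall>y\<in>X. x \<noteq> y \<longrightarrow> d x y = t)"

text \<open>Balls are identified when they are equal as subsets of \<open>X\<close>, whatever their centres and radii.\<close>

definition closed_balls :: "'a set \<Rightarrow> ('a \<Rightarrow> 'a \<Rightarrow> real) \<Rightarrow> 'a set set" where
  "closed_balls X d = {Metric_space.mcball X d c r | c r. c \<in> X \<and> 0 \<le> r}"

text \<open>Suprema and infima are those of the conditionally complete lattice of reals, so the value is
  meaningful only for nonempty sets \<open>A\<close>, \<open>B\<close> that are bounded with respect to \<open>d\<close>; all members of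
  \<open>closed_balls X d\<close> are such sets.\<close>

definition hausdorff_distance :: "('a \<Rightarrow> 'a \<Rightarrow> real) \<Rightarrow> 'a set \<Rightarrow> 'a set \<Rightarrow> real" where
  "hausdorff_distance d A B =
     max (SUP a\<in>A. INF b\<in>B. d a b) (SUP b\<in>B. INF a\<in>A. d a b)"

definition isometric_spaces ::
  "'a set \<Rightarrow> ('a \<Rightarrow> 'a \<Rightarrow> real) \<Rightarrow> 'b set \<Rightarrow> ('b \<Rightarrow> 'b \<Rightarrow> real) \<Rightarrow> bool" where
  "isometric_spaces X d Y e \<longleftrightarrow>
     (\<exists>f. bij_betw f X Y \<and> (\<forall>x\<in>X. \<forall>y\<in>X. e (f x) (f y) = d x y))"

end

(* Any two distinct nonempty subsets of an equidistant space with common distance t are at Hausdorff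
   distance t, so isometry with the space of balls is a question of cardinality only. The balls are
   the singletons and X itself, which adds one new element exactly when X has at least two points;
   this changes the cardinality iff X is finite. *)
theory Submission
  imports Defs
begin

text \<open>Only the comparison of the radius with \<open>t\<close> matters: below \<open>t\<close>
  a ball is reduced to its centre, from \<open>t\<close> on it is all of \<open>X\<close>. For a
  one-point \<open>X\<close> the two kinds coincide, which \<open>insert\<close> absorbs.\<close>

lemma closed_balls_equidistant:
  assumes "X \<noteq> {}" and "Metric_space X d" and "t > 0"
    and t: "\<And>x y. x \<in> X \<Longrightarrow> y \<in> X \<Longrightarrow> x \<noteq> y \<Longrightarrow> d x y = t"
  shows "closed_balls X d = insert X ((\<lambda>x. {x}) ` X)"
proof -
  interpret Metric_space X d by fact
  have ball: "mcball c r = (if r < t then {c} else X)" if "c \<in> X" "0 \<le> r" for c r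
  proof -
    have "d c x \<le> r \<longleftrightarrow> x = c \<or> t \<le> r" if "x \<in> X" for x
      using that t[of c x] \<open>c \<in> X\<close> \<open>0 \<le> r\<close> by (cases "x = c") auto
    then show ?thesis
      using that by (auto simp: mcball_def)
  qed
  have sub: "A \<in> insert X ((\<lambda>x. {x}) ` X)" if "A \<in> closed_balls X d" for A
    using that by (auto simp: closed_balls_def ball split: if_splits)
  obtain c where "c \<in> X" using assms(1) by blast
  then have "X = mcball c t" using ball[of c t] \<open>t > 0\<close> by simp
  then have "X \<in> closed_balls X d"
    unfolding closed_balls_def using \<open>c \<in> X\<close> \<open>t > 0\<close> less_imp_le by blast
  moreover have "{x} \<in> closed_balls X d" if "x \<in> X" for x
  proof -
    have "{x} = mcball x 0" using ball[of x 0] that \<open>t > 0\<close> by simp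
    then show ?thesis unfolding closed_balls_def using that by blast
  qed
  ultimately show ?thesis using sub by blast
qed

text \<open>The distance from a point to a nonempty set is 0 or \<open>t\<close> according to
  membership, so each one-sided supremum is 0 or \<open>t\<close> according to inclusion, and the
  maximum vanishes iff both inclusions hold.\<close>

lemma hausdorff_distance_equidistant:
  assumes "Metric_space X d" and "t > 0"
    and t: "\<And>x y. x \<in> X \<Longrightarrow> y \<in> X \<Longrightarrow> x \<noteq> y \<Longrightarrow> d x y = t"
    and "A \<subseteq> X" "A \<noteq> {}" "B \<subseteq> X" "B \<noteq> {}"
  shows "hausdorff_distance d A B = (if A = B then 0 else t)"
proof -
  interpret Metric_space X d by fact
  have inf: "(INF b\<in>B. d a b) = (if a \<in> B then 0 else t)"
    if "a \<in> X" "B \<subseteq> X" "B \<noteq> {}" for a B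
  proof (cases "a \<in> B")
    case True
    then have "(INF b\<in>B. d a b) = 0"
      using that by (intro cInf_eq_minimum) (auto simp: image_iff intro: bexI[of _ a])
    with True show ?thesis by simp
  next
    case False
    then have "(INF b\<in>B. d a b) = (INF b\<in>B. t)"
      using that t by (intro INF_cong) auto
    with False that show ?thesis by simp
  qed
  have sup: "(SUP a\<in>A. INF b\<in>B. d a b) = (if A \<subseteq> B then 0 else t)"
    if "A \<subseteq> X" "A \<noteq> {}" "B \<subseteq> X" "B \<noteq> {}" for A B
  proof -
    have "(SUP a\<in>A. INF b\<in>B. d a b) = (SUP a\<in>A. if a \<in> B then 0 else t)"
      using that by (intro SUP_cong refl inf) auto
    \<comment> \<open>The supremum is attained: at any point of \<open>A - B\<close> if there is
      one, otherwise at any point of the nonempty set \<open>A\<close>.\<close>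
    also have "\<dots> = (if A \<subseteq> B then 0 else t)"
      using that \<open>t > 0\<close> by (intro cSup_eq_maximum) (auto simp: image_iff)
    finally show ?thesis .
  qed
  \<comment> \<open>Symmetry of \<open>d\<close> brings the second term of the maximum into the form
    of \<open>sup\<close> with \<open>A\<close> and \<open>B\<close> exchanged.\<close>
  have "(SUP b\<in>B. INF a\<in>A. d a b) = (SUP b\<in>B. INF a\<in>A. d b a)"
    by (intro SUP_cong INF_cong refl commute)
  then show ?thesis
    unfolding hausdorff_distance_def sup[OF assms(4-7)]
    using \<open>t > 0\<close> sup[OF assms(6,7,4,5)] by auto
qed

text \<open>The singletons are a copy of \<open>X\<close>, so the question is whether one further
  element changes the cardinality. It is really a new element unless \<open>X\<close> is itself a
  singleton.\<close>

lemma singletons_insert_bij_iff: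
  assumes "X \<noteq> {}"
  shows "(\<exists>f. bij_betw f X (insert X ((\<lambda>x. {x}) ` X))) \<longleftrightarrow> card X = 1 \<or> infinite X"
proof -
  let ?S = "(\<lambda>x. {x}) ` X"
  have S: "bij_betw (\<lambda>x. {x}) X ?S" by (simp add: bij_betw_def)
  show ?thesis
  proof (cases "X \<in> ?S")
    case True
    then have "card X = 1" by auto
    moreover have "insert X ?S = ?S" using True by blast
    ultimately show ?thesis using S by auto
  next
    case new: False
    then have "card X \<noteq> 1" by (metis card_1_singletonE imageI insertI1)
    show ?thesis
    proof (cases "finite X")
      case True
      then have "card (insert X ?S) = Suc (card X)"
        using new bij_betw_same_card[OF S] by simp
      then show ?thesis
        using \<open>card X \<noteq> 1\<close> True bij_betw_same_card by (metis n_not_Suc_n)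
    next
      case False
      then have "infinite (insert X ?S)"
        using bij_betw_finite[OF S] by simp
      \<comment> \<open>An infinite set is equinumerous with itself minus a point. Since
        \<open>g\<close> maps the larger family onto the singletons, its inverse is what extends the
        copy of \<open>X\<close> to the whole family.\<close>
      then obtain g where "bij_betw g (insert X ?S) (insert X ?S - {X})"
        using infinite_imp_bij_betw[of "insert X ?S" X] by metis
      moreover have "insert X ?S - {X} = ?S" using new by blast
      ultimately have "bij_betw (inv_into (insert X ?S) g \<circ> (\<lambda>x. {x})) X (insert X ?S)"
        using bij_betw_trans[OF S bij_betw_inv_into] by simp
      with False show ?thesis by blast
    qed
  qed
qed

theorem theorem5p7:
  fixes X :: "'a set" and d :: "'a \<Rightarrow> 'a \<Rightarrow> real"
  assumes "X \<noteq> {}"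
    and "equidistant_metric X d"
  shows "(card X = 1 \<or> infinite X) \<longleftrightarrow>
         isometric_spaces X d (closed_balls X d) (hausdorff_distance d)"
proof -
  obtain t where "Metric_space X d" "t > 0"
    and t: "\<And>x y. x \<in> X \<Longrightarrow> y \<in> X \<Longrightarrow> x \<noteq> y \<Longrightarrow> d x y = t"
    using assms(2) unfolding equidistant_metric_def by blast
  interpret Metric_space X d by fact
  let ?B = "insert X ((\<lambda>x. {x}) ` X)"
  \<comment> \<open>Every bijection onto \<open>?B\<close> is automatically an isometry: by
    injectivity distinct points go to distinct nonempty subsets, and both pairs are at distance
    \<open>t\<close>.\<close>
  have "hausdorff_distance d (f x) (f y) = d x y"
    if f: "bij_betw f X ?B" and "x \<in> X" "y \<in> X" for f x y
  proof -
    have ne: "f z \<subseteq> X \<and> f z \<noteq> {}" if "z \<in> X" for z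
      using bij_betwE[OF f] that assms(1) by fastforce
    have "f x = f y \<longleftrightarrow> x = y"
      using f that unfolding bij_betw_def by (metis inj_on_eq_iff)
    then show ?thesis
      using hausdorff_distance_equidistant[OF \<open>Metric_space X d\<close> \<open>t > 0\<close> t, of "f x" "f y"]
        ne that t by auto
  qed
  then have "isometric_spaces X d ?B (hausdorff_distance d) \<longleftrightarrow> (\<exists>f. bij_betw f X ?B)"
    unfolding isometric_spaces_def by blast
  then show ?thesis
    using closed_balls_equidistant[OF assms(1) \<open>Metric_space X d\<close> \<open>t > 0\<close> t]
      singletons_insert_bij_iff[OF assms(1)] by simp
qed

end
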